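(* Let $q\ge2$, $n\ge0$ be integers and let $G=(g_{ij})_{i,j=0}^{q-1}$ be a $q\times q$ generalized Hadamard matrix. (1) If in addition $G$ is symmetric, then for all $p,t\in V(n,q)$, \[ \sum_{s\in V(n,q)} MG(p;s)\,\overline{MG(s;t)}=q^n\,\delta_{p,t}. \] (2) If in addition the core of $G$ is symmetric, $g_{0,j}=1$ for $j=0,\ldots,q-1$ and $g_{i,0}=-1$ for $i=1,\ldots,q-1$, then for all $p,t\in V(n,q)$, \[ \sum_{s\in V(n,q)} (-1)^{s_0}\,MG(p;s)\,\overline{MG(s;t)}=(-1)^{t_0}\,q^n\,\delta_{p,t}. \] Here $\delta_{p,t}=1$ if $p_i=t_i$ for all $i$ and $0$ otherwise.
   Context: A $q\times q$ complex matrix $H$ is a generalized Hadamard matrix if $H\overline{H}^T=qI_q$. The core of $G$ is the matrix $(g_{ij})_{i,j=1}^{q-1}$ obtained by deleting the first row and first column. For integers $n\ge0$, $q\ge2$, $V(n,q)=\{p=(p_0,\ldots,p_{q-1})\in\mathbb{N}_0^q : \sum_i p_i=n\}$, and $p!=\prod_{i}p_i!$. For $p,s\in V(n,q)$, \[ MG(p;s)=s!\sum_{(r_{i,j})}\prod_{a=0}^{q-1}\prod_{b=0}^{q-1}\frac{g_{ab}^{r_{a,b}}}{r_{a,b}!}, \] the sum being over all families of nonnegative integers $r_{i,j}$ ($i,j=0,\ldots,q-1$) with $\sum_j r_{i,j}=s_i$ for all $i$ and $\sum_i r_{i,j}=p_j$ for all $j$ (with $0^0=1$). *)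

theory Defs
  imports Complex_Main "Jordan_Normal_Form.Matrix" "Jordan_Normal_Form.Determinant"
begin

(* Only H * conj(H)^T = q I is required; the entries need not be unimodular. *)
definition generalized_hadamard :: "nat \<Rightarrow> complex mat \<Rightarrow> bool" where
  "generalized_hadamard q H \<longleftrightarrow>
     H \<in> carrier_mat q q \<and>
     H * transpose_mat (map_mat cnj H) = of_nat q \<cdot>\<^sub>m 1\<^sub>m q"

definition symmetric_matrix :: "'a mat \<Rightarrow> bool" where
  "symmetric_matrix A \<longleftrightarrow> transpose_mat A = A"

definition core :: "'a mat \<Rightarrow> 'a mat" where
  "core G = mat_delete G 0 0"

definition V :: "nat \<Rightarrow> nat \<Rightarrow> nat vec set" where
  "V n q = {p \<in> carrier_vec q. (\<Sum>i<q. p $ i) = n}"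

definition vec_fact :: "nat vec \<Rightarrow> nat" where
  "vec_fact p = (\<Prod>i<dim_vec p. fact (p $ i))"

definition contingency_tables :: "nat \<Rightarrow> nat vec \<Rightarrow> nat vec \<Rightarrow> nat mat set" where
  "contingency_tables q s p =
     {r \<in> carrier_mat q q.
        (\<forall>i<q. (\<Sum>j<q. r $$ (i, j)) = s $ i) \<and>
        (\<forall>j<q. (\<Sum>i<q. r $$ (i, j)) = p $ j)}"

(* MG G p s is MG(p;s): the row sums of r are given by the second index s,
   the column sums by the first index p. *)
definition MG :: "complex mat \<Rightarrow> nat vec \<Rightarrow> nat vec \<Rightarrow> complex" where
  "MG G p s =
     (let q = dim_row G in
        of_nat (vec_fact s) *
        (\<Sum>r\<in>contingency_tables q s p.
           \<Prod>a<q. \<Prod>b<q. G $$ (a, b) ^ (r $$ (a, b)) / fact (r $$ (a, b))))"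

end

theory Submission
  imports Defs
begin

text \<open>
  Fix a word \<open>u\<close> of length \<open>n\<close> over the alphabet \<open>{0,\<dots>,q-1}\<close> in which each letter \<open>a\<close> occurs \<open>s\<^sub>a\<close>
  times. Then \<open>MG(p;s)\<close> is the sum, over all words \<open>w\<close> in which each letter \<open>a\<close> occurs \<open>p\<^sub>a\<close> times, of
  the products of the entries of \<open>G\<close> at the positions \<open>(u\<^sub>i, w\<^sub>i)\<close>: a contingency table records how often
  each pair of letters occurs, and the factorials count the words \<open>w\<close> with a given table. In this
  form a sum over \<open>s\<close> of products of two \<open>MG\<close> becomes a sum over all words and factors over the
  \<open>n\<close> positions into ordinary matrix products. Both parts follow because, with \<open>D = I\<close> in (1) and
  \<open>D = diag(-1,1,\<dots>,1)\<close> in (2), the matrix \<open>DG\<close> is symmetric, so that the conjugate of \<open>G\<close> times \<open>DG\<close>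
  is \<open>qD\<close>.
\<close>

section \<open>Words, letter counts and weights\<close>

definition words :: "nat \<Rightarrow> nat \<Rightarrow> nat list set" where
  "words q n = {w. set w \<subseteq> {..<q} \<and> length w = n}"

definition letter_counts :: "nat \<Rightarrow> nat list \<Rightarrow> nat vec" where
  "letter_counts q w = vec q (count_list w)"

text \<open>For words of length \<open>n\<close> this is the entry at row \<open>u\<close> and
  column \<open>w\<close> of the \<open>n\<close>-fold Kronecker power of the matrix
  \<open>f\<close>, so matrix operations can be carried out one position at a time.\<close>

definition word_weight :: "(nat \<Rightarrow> nat \<Rightarrow> 'a::comm_semiring_1) \<Rightarrow> nat list \<Rightarrow> nat list \<Rightarrow> 'a" where
  "word_weight f u w = prod_list (map2 f u w)"

lemma finite_words [simp]: "finite (words q n)"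
  unfolding words_def using finite_lists_length_eq[of "{..<q}" n] by simp

lemma words_0 [simp]: "words q 0 = {[]}"
  by (auto simp: words_def)

lemma words_Suc: "words q (Suc n) = (\<Union>b<q. Cons b ` words q n)"
  by (auto simp: words_def length_Suc_conv image_iff)

lemma sum_words_Suc: "(\<Sum>w\<in>words q (Suc n). f w) = (\<Sum>b<q. \<Sum>w\<in>words q n. f (b # w))"
proof -
  have "(\<Sum>w\<in>words q (Suc n). f w) = (\<Sum>b<q. sum f (Cons b ` words q n))"
    unfolding words_Suc by (rule sum.UNION_disjoint) auto
  also have "\<dots> = (\<Sum>b<q. \<Sum>w\<in>words q n. f (b # w))"
    by (intro sum.cong[OF refl], subst sum.reindex) auto
  finally show ?thesis .
qed

lemma sum_count_list:
  fixes q :: nat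
  assumes "set w \<subseteq> {..<q}"
  shows "(\<Sum>a<q. count_list w a) = length w"
  using sum_count_set[OF assms] by simp

lemma letter_counts_in_V: "w \<in> words q n \<Longrightarrow> letter_counts q w \<in> V n q"
  by (auto simp: words_def V_def letter_counts_def sum_count_list)

lemma letter_counts_surj:
  assumes "t \<in> V n q"
  obtains u where "u \<in> words q n" "letter_counts q u = t"
proof -
  \<comment> \<open>Any ordering of the multiset that holds each letter \<open>a\<close> exactly
    \<open>t $ a\<close> times serves as the word.\<close>
  obtain u where u: "mset u = (\<Sum>a<q. replicate_mset (t $ a) a)"
    using ex_mset by blast
  have cnt: "count_list u b = (if b < q then t $ b else 0)" for b
  proof -
    have "count_list u b = count (mset u) b"
      by (simp add: count_mset)
    also have "\<dots> = (\<Sum>a<q. if a = b then t $ a else 0)"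
      unfolding u by (auto simp: count_sum intro!: sum.cong)
    finally show ?thesis
      by simp
  qed
  have set: "set u \<subseteq> {..<q}"
    using cnt by (metis count_list_0_iff lessThan_iff subsetI)
  have "length u = n"
    using sum_count_list[OF set] cnt assms by (simp add: V_def)
  moreover have "letter_counts q u = t"
    using assms cnt by (auto simp: letter_counts_def V_def)
  ultimately show ?thesis
    using set by (intro that[of u]) (auto simp: words_def)
qed

section \<open>Pair counts of two words\<close>

lemma prod_list_eq_prod_count_list:
  fixes d :: "'b \<Rightarrow> 'a::comm_semiring_1"
  assumes "finite A" "set v \<subseteq> A"
  shows "prod_list (map d v) = (\<Prod>a\<in>A. d a ^ count_list v a)"
  using assms(2)
proof (induction v)
  case (Cons b v)
  have "(\<Prod>a\<in>A. d a ^ count_list (b # v) a) =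
        (\<Prod>a\<in>A. (if a = b then d a else 1) * d a ^ count_list v a)"
    by (intro prod.cong) auto
  also have "\<dots> = d b * (\<Prod>a\<in>A. d a ^ count_list v a)"
    using Cons.prems assms(1) by (simp add: prod.distrib)
  finally show ?case
    using Cons by simp
qed simp

lemma row_sum_count_list_zip:
  fixes q :: nat
  assumes "length u = length w" "set w \<subseteq> {..<q}"
  shows "(\<Sum>b<q. count_list (zip u w) (a, b)) = count_list u a"
  using assms
proof (induction u w rule: list_induct2)
  case (Cons x u y w)
  have "(\<Sum>b<q. count_list (zip (x # u) (y # w)) (a, b)) =
        (\<Sum>b<q. (if b = y then (if x = a then 1 else 0) else 0) + count_list (zip u w) (a, b))"
    by (intro sum.cong) auto
  also have "\<dots> = (if x = a then 1 else 0) + count_list u a"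
    using Cons by (simp add: sum.distrib)
  finally show ?case by simp
qed simp

lemma column_sum_count_list_zip:
  fixes q :: nat
  assumes "length u = length w" "set u \<subseteq> {..<q}"
  shows "(\<Sum>a<q. count_list (zip u w) (a, b)) = count_list w b"
  using assms
proof (induction u w rule: list_induct2)
  case (Cons x u y w)
  have "(\<Sum>a<q. count_list (zip (x # u) (y # w)) (a, b)) =
        (\<Sum>a<q. (if a = x then (if y = b then 1 else 0) else 0) + count_list (zip u w) (a, b))"
    by (intro sum.cong) auto
  also have "\<dots> = (if y = b then 1 else 0) + count_list w b"
    using Cons by (simp add: sum.distrib)
  finally show ?case by simp
qed simp

text \<open>The positions of \<open>u\<close> carrying the letter \<open>a\<close> can be filled
  independently for each \<open>a\<close>, in a multinomial number of ways. Clearing denominators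
  keeps the identity in the natural numbers and suits an induction that strips the first
  position.\<close>

lemma card_words_pair_counts:
  fixes r :: "nat \<times> nat \<Rightarrow> nat"
  assumes "set u \<subseteq> {..<q}" "\<And>a. a < q \<Longrightarrow> (\<Sum>b<q. r (a, b)) = count_list u a"
  shows "card {w \<in> words q (length u). \<forall>x\<in>{..<q}\<times>{..<q}. count_list (zip u w) x = r x}
           * (\<Prod>x\<in>{..<q}\<times>{..<q}. fact (r x)) = (\<Prod>a<q. fact (count_list u a) :: nat)"
  using assms
proof (induction u arbitrary: r)
  case Nil
  then have "r x = 0" if "x \<in> {..<q}\<times>{..<q}" for x
    using that by force
  then have "{w \<in> words q (length []). \<forall>x\<in>{..<q}\<times>{..<q}. count_list (zip [] w) x = r x} = {[]}"
    and "(\<Prod>x\<in>{..<q}\<times>{..<q}. fact (r x)) = (1::nat)"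
    by auto
  then show ?case by simp
next
  case (Cons c u)
  let ?Q = "{..<q}\<times>{..<q}"
  let ?F = "\<lambda>r. \<Prod>x\<in>?Q. fact (r x) :: nat"
  let ?N = "\<lambda>r. {w \<in> words q (length u). \<forall>x\<in>?Q. count_list (zip u w) x = r x}"
  \<comment> \<open>\<open>S b\<close> collects the tails of the admissible words that start with
    \<open>b\<close>.\<close>
  define S where "S b = {w \<in> words q (length u). \<forall>x\<in>?Q. count_list (zip (c # u) (b # w)) x = r x}" for b
  have c: "c < q" and u: "set u \<subseteq> {..<q}"
    using Cons.prems(1) by auto
  have S: "card (S b) * ?F r = r (c, b) * (\<Prod>a<q. fact (count_list u a))" if b: "b < q" for b
  proof (cases "r (c, b)")
    case 0
    \<comment> \<open>The leading pair \<open>(c, b)\<close> occurs at least once, which a zero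
      entry of \<open>r\<close> forbids.\<close>
    have "count_list (zip (c # u) (b # w)) (c, b) \<noteq> r (c, b)" for w
      using 0 by simp
    then have "S b = {}"
      using b c unfolding S_def by blast
    then show ?thesis
      using 0 by simp
  next
    case (Suc m)
    \<comment> \<open>The counts left for the tails once the leading pair is removed. Lowering one
      entry from \<open>Suc m\<close> to \<open>m\<close> releases the factor
      \<open>r (c, b)\<close> from the product of factorials.\<close>
    define r' where "r' = r((c, b) := m)"
    have "S b = ?N r'"
      unfolding S_def r'_def using Suc b c by (intro Collect_cong conj_cong ball_cong) auto
    moreover have "?F r = r (c, b) * ?F r'"
    proof -
      have "?F r = fact (r (c, b)) * (\<Prod>x\<in>?Q - {(c, b)}. fact (r x))"
        using b c by (intro prod.remove) auto
      also have "\<dots> = r (c, b) * (fact (r' (c, b)) * (\<Prod>x\<in>?Q - {(c, b)}. fact (r' x)))"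
        by (simp add: r'_def Suc algebra_simps)
      also have "fact (r' (c, b)) * (\<Prod>x\<in>?Q - {(c, b)}. fact (r' x)) = ?F r'"
        using b c by (intro prod.remove[symmetric]) auto
      finally show ?thesis .
    qed
    moreover have "card (?N r') * ?F r' = (\<Prod>a<q. fact (count_list u a))"
    proof (rule Cons.IH[OF u])
      fix a assume a: "a < q"
      have "(\<Sum>b'<q. r (a, b')) = (\<Sum>b'<q. r' (a, b') + (if b' = b then (if a = c then 1 else 0) else 0))"
        by (intro sum.cong) (auto simp: r'_def Suc)
      then have "(\<Sum>b'<q. r (a, b')) = (\<Sum>b'<q. r' (a, b')) + (if a = c then 1 else 0)"
        using b by (simp add: sum.distrib)
      then show "(\<Sum>b'<q. r' (a, b')) = count_list u a"
        using Cons.prems(2)[OF a] by (auto split: if_splits)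
    qed
    ultimately show ?thesis
      by (simp add: algebra_simps)
  qed
  have "{w \<in> words q (length (c # u)). \<forall>x\<in>?Q. count_list (zip (c # u) w) x = r x} =
        (\<Union>b<q. Cons b ` S b)"
    unfolding S_def length_Cons words_Suc by blast
  also have "card \<dots> = (\<Sum>b<q. card (Cons b ` S b))"
    by (intro card_UN_disjoint) (auto simp: S_def)
  also have "\<dots> = (\<Sum>b<q. card (S b))"
    by (simp add: card_image)
  finally have "card {w \<in> words q (length (c # u)). \<forall>x\<in>?Q. count_list (zip (c # u) w) x = r x} * ?F r
      = (\<Sum>b<q. r (c, b)) * (\<Prod>a<q. fact (count_list u a))"
    using S by (simp add: sum_distrib_right)
  \<comment> \<open>Row \<open>c\<close> of \<open>r\<close> sums to the number of occurrences of
    \<open>c\<close> in \<open>c # u\<close>; this factor raises the factorial for \<open>c\<close>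
    from \<open>u\<close> to \<open>c # u\<close>.\<close>
  also have "\<dots> = Suc (count_list u c) * (\<Prod>a<q. fact (count_list u a))"
    using Cons.prems(2)[OF c] by simp
  also have "\<dots> = (\<Prod>a<q. (if a = c then Suc (count_list u c) else 1) * fact (count_list u a))"
    using c by (simp add: prod.distrib)
  also have "\<dots> = (\<Prod>a<q. fact (count_list (c # u) a))"
    by (intro prod.cong) auto
  finally show ?case .
qed

section \<open>Contingency tables and \<open>MG\<close> as a sum over words\<close>

lemma finite_contingency_tables: "finite (contingency_tables q s p)"
proof (rule finite_subset)
  let ?M = "\<Sum>i<q. s $ i"
  show "contingency_tables q s p \<subseteq>
      (\<lambda>f. mat q q f) ` (({..<q}\<times>{..<q}) \<rightarrow>\<^sub>E {..?M})"
  proof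
    fix r assume r: "r \<in> contingency_tables q s p"
    \<comment> \<open>Each entry is bounded by its row sum, hence by the total, so the tables lie in
      the image of a finite function space.\<close>
    have "r $$ (i, j) \<le> ?M" if "i < q" "j < q" for i j
    proof -
      have "r $$ (i, j) \<le> (\<Sum>j<q. r $$ (i, j))"
        using that by (intro member_le_sum) auto
      also have "\<dots> = s $ i"
        using r that by (auto simp: contingency_tables_def)
      also have "\<dots> \<le> ?M"
        using that by (intro member_le_sum) auto
      finally show ?thesis .
    qed
    moreover have "r = mat q q (restrict (\<lambda>x. r $$ x) ({..<q}\<times>{..<q}))"
      using r by (intro eq_matI) (auto simp: contingency_tables_def)
    ultimately show "r \<in> (\<lambda>f. mat q q f) ` (({..<q}\<times>{..<q}) \<rightarrow>\<^sub>E {..?M})"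
      by (intro image_eqI[of _ _ "restrict (\<lambda>x. r $$ x) ({..<q}\<times>{..<q})"]) auto
  qed
  show "finite ((\<lambda>f. mat q q f) ` (({..<q}\<times>{..<q}) \<rightarrow>\<^sub>E {..?M}))"
    by (intro finite_imageI finite_PiE) auto
qed

text \<open>Positions with the same pair of letters contribute the same factor, so the weight
  depends only on the table of pair counts.\<close>

lemma word_weight_eq_prod_pair_counts:
  assumes "u \<in> words q n" "w \<in> words q n"
  shows "word_weight f u w = (\<Prod>a<q. \<Prod>b<q. f a b ^ count_list (zip u w) (a, b))"
proof -
  have "set (zip u w) \<subseteq> {..<q}\<times>{..<q}"
    using assms by (auto simp: words_def dest: set_zip_leftD set_zip_rightD)
  then show ?thesis
    unfolding word_weight_def
    by (subst prod_list_eq_prod_count_list[of "{..<q}\<times>{..<q}"]) (auto simp: prod.cartesian_product split_beta)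
qed

text \<open>Sort the words \<open>w\<close> by their table of pair counts with \<open>u\<close>: the
  weight is constant on each class, and \<open>card_words_pair_counts\<close> gives the class size.
  Since \<open>u\<close> may be any word with the given letter counts, a sum over count vectors can
  later be turned into a sum over words.\<close>

lemma MG_eq_sum_word_weight:
  assumes G: "dim_row G = q" and u: "u \<in> words q n" and p: "p \<in> carrier_vec q"
  shows "MG G p (letter_counts q u) =
    (\<Sum>w | w \<in> words q n \<and> letter_counts q w = p. word_weight (\<lambda>a b. G $$ (a, b)) u w)"
proof -
  let ?Q = "{..<q}\<times>{..<q}"
  let ?s = "letter_counts q u"
  let ?T = "contingency_tables q ?s p"
  let ?W = "{w \<in> words q n. letter_counts q w = p}"
  let ?g = "\<lambda>r::nat mat. \<Prod>a<q. \<Prod>b<q. G $$ (a, b) ^ r $$ (a, b)"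
  define \<tau> where "\<tau> w = mat q q (count_list (zip u w))" for w
  have len: "length u = n" and setu: "set u \<subseteq> {..<q}"
    using u by (auto simp: words_def)
  have \<tau>: "\<tau> ` ?W \<subseteq> ?T"
  proof (clarsimp simp: contingency_tables_def \<tau>_def letter_counts_def)
    fix w assume w: "w \<in> words q n"
    then have "length u = length w" "set w \<subseteq> {..<q}"
      using len by (auto simp: words_def)
    then show "(\<forall>i<q. (\<Sum>j<q. count_list (zip u w) (i, j)) = count_list u i) \<and>
        (\<forall>j<q. (\<Sum>i<q. count_list (zip u w) (i, j)) = count_list w j)"
      using setu by (simp add: row_sum_count_list_zip column_sum_count_list_zip)
  qed
  have fiber: "of_nat (vec_fact ?s) * (\<Prod>a<q. \<Prod>b<q. G $$ (a, b) ^ (r $$ (a, b)) / fact (r $$ (a, b)))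
      = of_nat (card {w \<in> ?W. \<tau> w = r}) * ?g r" if r: "r \<in> ?T" for r
  proof -
    have iff: "\<tau> w = r \<longleftrightarrow> (\<forall>x\<in>?Q. count_list (zip u w) x = r $$ x)" for w
    proof -
      have "r \<in> carrier_mat q q"
        using r by (simp add: contingency_tables_def)
      then show ?thesis
        by (auto simp: \<tau>_def mat_eq_iff)
    qed
    \<comment> \<open>The column sums of \<open>r\<close> determine the letter counts of
      \<open>w\<close>, so the fiber of \<open>\<tau>\<close> over \<open>r\<close> is exactly the
      set counted by \<open>card_words_pair_counts\<close>.\<close>
    have "letter_counts q w = p" if w: "w \<in> words q n" and eq: "\<tau> w = r" for w
    proof (rule eq_vecI)
      show "dim_vec (letter_counts q w) = dim_vec p"
        using p by (simp add: letter_counts_def)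
      fix j assume "j < dim_vec p"
      then have j: "j < q" using p by simp
      have "count_list w j = (\<Sum>i<q. count_list (zip u w) (i, j))"
        using w setu len by (intro column_sum_count_list_zip[symmetric]) (auto simp: words_def)
      also have "\<dots> = (\<Sum>i<q. r $$ (i, j))"
        using eq j by (intro sum.cong) (auto simp: iff)
      also have "\<dots> = p $ j"
        using r j by (auto simp: contingency_tables_def)
      finally show "letter_counts q w $ j = p $ j"
        using j by (simp add: letter_counts_def)
    qed
    then have fib: "{w \<in> ?W. \<tau> w = r} =
        {w \<in> words q (length u). \<forall>x\<in>?Q. count_list (zip u w) x = r $$ x}"
      using len by (auto simp: iff)
    have "card {w \<in> ?W. \<tau> w = r} * (\<Prod>x\<in>?Q. fact (r $$ x)) = (\<Prod>a<q. fact (count_list u a))"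
      unfolding fib using r
      by (intro card_words_pair_counts setu) (auto simp: contingency_tables_def letter_counts_def)
    also have "\<dots> = vec_fact ?s"
      by (simp add: vec_fact_def letter_counts_def)
    finally have "vec_fact ?s = card {w \<in> ?W. \<tau> w = r} * (\<Prod>x\<in>?Q. fact (r $$ x))"
      by (rule sym)
    then have "of_nat (vec_fact ?s) =
        (of_nat (card {w \<in> ?W. \<tau> w = r}) * (\<Prod>x\<in>?Q. fact (r $$ x)) :: complex)"
      by (simp only: of_nat_mult of_nat_prod of_nat_fact)
    moreover have "(\<Prod>a<q. \<Prod>b<q. G $$ (a, b) ^ (r $$ (a, b)) / fact (r $$ (a, b))) =
        ?g r / (\<Prod>x\<in>?Q. fact (r $$ x))"
      by (simp add: prod_dividef prod.cartesian_product)
    ultimately show ?thesis by simp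
  qed
  have "(\<Sum>w\<in>?W. word_weight (\<lambda>a b. G $$ (a, b)) u w) = (\<Sum>w\<in>?W. ?g (\<tau> w))"
    using u by (intro sum.cong refl) (simp add: word_weight_eq_prod_pair_counts \<tau>_def)
  also have "\<dots> = (\<Sum>r\<in>?T. \<Sum>w\<in>{w \<in> ?W. \<tau> w = r}. ?g (\<tau> w))"
    using \<tau> by (intro sum.group[symmetric] finite_contingency_tables) auto
  also have "\<dots> = (\<Sum>r\<in>?T. of_nat (card {w \<in> ?W. \<tau> w = r}) * ?g r)"
    by (intro sum.cong refl) simp
  also have "\<dots> = MG G p ?s"
    unfolding MG_def Let_def G using fiber by (simp add: sum_distrib_left)
  finally show ?thesis by simp
qed

section \<open>Matrix operations on word weights\<close>

lemma sum_word_weight_mult: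
  assumes "length u = n" "length w = n"
  shows "(\<Sum>v\<in>words q n. word_weight f u v * word_weight g v w) =
         word_weight (\<lambda>a c. \<Sum>b<q. f a b * g b c) u w"
proof -
  have "length u = length w" using assms by simp
  then have "(\<Sum>v\<in>words q (length u). word_weight f u v * word_weight g v w) =
         word_weight (\<lambda>a c. \<Sum>b<q. f a b * g b c) u w"
  proof (induction u w rule: list_induct2)
    case (Cons x u y w)
    \<comment> \<open>The sum splits into the sum over the first letter of the middle word, which is
      one entry of the matrix product, times the sum over its tail.\<close>
    show ?case
      by (simp add: sum_words_Suc word_weight_def sum_product
            flip: Cons.IH[unfolded word_weight_def]) (simp add: mult_ac)
  qed (simp add: word_weight_def)
  then show ?thesis using assms by simp
qed

lemma word_weight_diagonal:
  assumes "length u = length w"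
  shows "word_weight (\<lambda>a c. if a = c then d a else 0) u w = (if u = w then prod_list (map d u) else 0)"
  using assms by (induction u w rule: list_induct2) (auto simp: word_weight_def)

lemma word_weight_scale_rows:
  assumes "length v = length w"
  shows "word_weight (\<lambda>a b. d a * f a b) v w = prod_list (map d v) * word_weight f v w"
  using assms by (induction v w rule: list_induct2) (auto simp: word_weight_def mult_ac)

lemma cnj_word_weight: "cnj (word_weight f u w) = word_weight (\<lambda>a b. cnj (f a b)) u w"
  by (induction u w rule: list_induct2') (auto simp: word_weight_def)

lemma word_weight_cong:
  assumes "u \<in> words q n" "w \<in> words q n"
    and "\<And>a b. a < q \<Longrightarrow> b < q \<Longrightarrow> f a b = g a b"
  shows "word_weight f u w = word_weight g u w"
  using assms by (simp add: word_weight_eq_prod_pair_counts)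

section \<open>Orthogonality relations\<close>

lemma generalized_hadamard_row_product:
  assumes "generalized_hadamard q G" "a < q" "c < q"
  shows "(\<Sum>b<q. G $$ (a, b) * cnj (G $$ (c, b))) = (if a = c then of_nat q else 0)"
proof -
  have G: "G \<in> carrier_mat q q"
    and eq: "G * transpose_mat (map_mat cnj G) = of_nat q \<cdot>\<^sub>m 1\<^sub>m q"
    using assms(1) by (auto simp: generalized_hadamard_def)
  have "(\<Sum>b<q. G $$ (a, b) * cnj (G $$ (c, b))) = (G * transpose_mat (map_mat cnj G)) $$ (a, c)"
    using G assms(2,3) by (simp add: scalar_prod_def lessThan_atLeast0)
  then show ?thesis
    using assms(2,3) by (simp add: eq)
qed

text \<open>The weight attached to \<open>s\<close> is the product of \<open>d\<close> over the
  letters of any word with counts \<open>s\<close>. It therefore distributes over positions and can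
  be absorbed as a scaling of the rows of \<open>G\<close>, which \<open>sym\<close> makes
  symmetric.\<close>

lemma MG_weighted_orthogonality:
  assumes H: "generalized_hadamard q G"
    and sym: "\<And>a b. a < q \<Longrightarrow> b < q \<Longrightarrow> d a * G $$ (a, b) = d b * G $$ (b, a)"
    and p: "p \<in> V n q" and t: "t \<in> V n q"
  shows "(\<Sum>s\<in>V n q. (\<Prod>a<q. d a ^ (s $ a)) * MG G p s * cnj (MG G s t)) =
         (\<Prod>a<q. d a ^ (t $ a)) * of_nat q ^ n * (if p = t then 1 else 0)"
proof -
  let ?g = "\<lambda>a b. G $$ (a, b)"
  let ?W = "\<lambda>p. {w \<in> words q n. letter_counts q w = p}"
  let ?d = "\<lambda>s::nat vec. \<Prod>a<q. d a ^ (s $ a)"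
  have G: "dim_row G = q"
    using H by (auto simp: generalized_hadamard_def)
  obtain u where u: "u \<in> words q n" and ut: "letter_counts q u = t"
    using letter_counts_surj[OF t] .
  have V: "s \<in> carrier_vec q" if "s \<in> V n q" for s
    using that by (simp add: V_def)
  have wlen: "length w = n" if "w \<in> words q n" for w
    using that by (simp add: words_def)
  have d: "?d (letter_counts q v) = prod_list (map d v)" if "v \<in> words q n" for v
    using that by (simp add: words_def letter_counts_def prod_list_eq_prod_count_list[of "{..<q}"])
  have entry: "(\<Sum>b<q. cnj (?g a b) * (d b * ?g b c)) = (if a = c then of_nat q * d a else 0)"
    if "a < q" "c < q" for a c
  proof -
    \<comment> \<open>Symmetry of the scaled matrix replaces column \<open>c\<close> of
      \<open>G\<close> by row \<open>c\<close> and moves the scalar out of the sum, leaving an inner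
      product of two rows.\<close>
    have "(\<Sum>b<q. cnj (?g a b) * (d b * ?g b c)) = (\<Sum>b<q. d c * (?g c b * cnj (?g a b)))"
      using sym that by (intro sum.cong refl) simp
    also have "\<dots> = (if a = c then of_nat q * d a else 0)"
      using generalized_hadamard_row_product[OF H that(2,1)]
      by (simp flip: sum_distrib_left)
    finally show ?thesis .
  qed
  have fin: "finite (V n q)"
  proof (rule finite_subset)
    show "V n q \<subseteq> letter_counts q ` words q n"
      using letter_counts_surj by blast
  qed simp
  have "(\<Sum>s\<in>V n q. ?d s * MG G p s * cnj (MG G s t)) =
        (\<Sum>s\<in>V n q. \<Sum>v\<in>?W s. ?d s * MG G p s * cnj (word_weight ?g u v))"
    using MG_eq_sum_word_weight[OF G u V] by (intro sum.cong refl) (simp add: ut sum_distrib_left)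
  also have "\<dots> = (\<Sum>s\<in>V n q. \<Sum>v\<in>?W s.
      ?d (letter_counts q v) * MG G p (letter_counts q v) * cnj (word_weight ?g u v))"
    by (intro sum.cong refl) auto
  \<comment> \<open>Every word has exactly one count vector, so summing over \<open>s\<close> and
    then over the words with counts \<open>s\<close> runs once through all words.\<close>
  also have "\<dots> = (\<Sum>v\<in>words q n.
      ?d (letter_counts q v) * MG G p (letter_counts q v) * cnj (word_weight ?g u v))"
    using letter_counts_in_V by (intro sum.group fin) auto
  \<comment> \<open>Here \<open>v\<close> itself represents its count vector in the first
    \<open>MG\<close>, so the two weights share \<open>v\<close> as middle index and sum to a matrix
    product.\<close>
  also have "\<dots> = (\<Sum>v\<in>words q n. \<Sum>w\<in>?W p.
      word_weight (\<lambda>a b. cnj (?g a b)) u v * word_weight (\<lambda>a b. d a * ?g a b) v w)"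
    using MG_eq_sum_word_weight[OF G _ V[OF p]]
    by (intro sum.cong refl)
      (simp add: d sum_distrib_left sum_distrib_right cnj_word_weight word_weight_scale_rows wlen mult_ac)
  also have "\<dots> = (\<Sum>w\<in>?W p. \<Sum>v\<in>words q n.
      word_weight (\<lambda>a b. cnj (?g a b)) u v * word_weight (\<lambda>a b. d a * ?g a b) v w)"
    by (rule sum.swap)
  also have "\<dots> = (\<Sum>w\<in>?W p. word_weight (\<lambda>a c. if a = c then of_nat q * d a else 0) u w)"
  proof (intro sum.cong refl)
    fix w assume "w \<in> ?W p"
    then have w: "w \<in> words q n" by simp
    show "(\<Sum>v\<in>words q n.
        word_weight (\<lambda>a b. cnj (?g a b)) u v * word_weight (\<lambda>a b. d a * ?g a b) v w) =
        word_weight (\<lambda>a c. if a = c then of_nat q * d a else 0) u w"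
      unfolding sum_word_weight_mult[OF wlen[OF u] wlen[OF w]]
      by (rule word_weight_cong[OF u w entry])
  qed
  also have "\<dots> = (\<Sum>w\<in>?W p. if u = w then of_nat q ^ n * ?d t else 0)"
  proof (intro sum.cong refl)
    fix w assume "w \<in> ?W p"
    then have "length u = length w"
      using u by (simp add: wlen)
    moreover have "prod_list (map (\<lambda>a. of_nat q * d a) xs) = of_nat q ^ length xs * prod_list (map d xs)" for xs
      by (induction xs) (auto simp: mult_ac)
    ultimately show "word_weight (\<lambda>a c. if a = c then of_nat q * d a else 0) u w =
        (if u = w then of_nat q ^ n * ?d t else 0)"
      using d[OF u] wlen[OF u] by (simp add: word_weight_diagonal ut)
  qed
  \<comment> \<open>Only \<open>w = u\<close> contributes, and \<open>u\<close>, having counts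
    \<open>t\<close>, lies in \<open>?W p\<close> exactly when \<open>p = t\<close>.\<close>
  also have "\<dots> = (if p = t then of_nat q ^ n * ?d t else 0)"
    using u ut by auto
  finally show ?thesis by simp
qed

theorem mainTheorem5:
  fixes q n :: nat and G :: "complex mat"
  assumes "q \<ge> 2" and "generalized_hadamard q G"
  shows "(symmetric_matrix G \<longrightarrow>
            (\<forall>p\<in>V n q. \<forall>t\<in>V n q.
               (\<Sum>s\<in>V n q. MG G p s * cnj (MG G s t))
                 = of_nat q ^ n * (if p = t then 1 else 0)))
       \<and> (symmetric_matrix (core G) \<and>
          (\<forall>j<q. G $$ (0, j) = 1) \<and>
          (\<forall>i\<in>{1..<q}. G $$ (i, 0) = - 1) \<longrightarrow>
            (\<forall>p\<in>V n q. \<forall>t\<in>V n q.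
               (\<Sum>s\<in>V n q. (- 1) ^ (s $ 0) * MG G p s * cnj (MG G s t))
                 = (- 1) ^ (t $ 0) * of_nat q ^ n * (if p = t then 1 else 0)))"
proof (intro conjI impI ballI)
  fix p t assume sym: "symmetric_matrix G" and pt: "p \<in> V n q" "t \<in> V n q"
  have G: "G \<in> carrier_mat q q"
    using assms(2) by (simp add: generalized_hadamard_def)
  have "G $$ (a, b) = G $$ (b, a)" if "a < q" "b < q" for a b
    using sym G that by (metis symmetric_matrix_def index_transpose_mat(1) carrier_matD)
  then show "(\<Sum>s\<in>V n q. MG G p s * cnj (MG G s t)) = of_nat q ^ n * (if p = t then 1 else 0)"
    using MG_weighted_orthogonality[OF assms(2) _ pt, of "\<lambda>_. 1"] by simp
next
  fix p t
  assume "symmetric_matrix (core G) \<and> (\<forall>j<q. G $$ (0, j) = 1) \<and> (\<forall>i\<in>{1..<q}. G $$ (i, 0) = - 1)"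
    and pt: "p \<in> V n q" "t \<in> V n q"
  then have sym: "symmetric_matrix (core G)"
    and row: "\<And>j. j < q \<Longrightarrow> G $$ (0, j) = 1"
    and col: "\<And>i. 0 < i \<Longrightarrow> i < q \<Longrightarrow> G $$ (i, 0) = - 1"
    by auto
  have G: "G \<in> carrier_mat q q"
    using assms(2) by (simp add: generalized_hadamard_def)
  define d :: "nat \<Rightarrow> complex" where "d a = (if a = 0 then - 1 else 1)" for a
  have core_sym: "G $$ (Suc a, Suc b) = G $$ (Suc b, Suc a)" if "Suc a < q" "Suc b < q" for a b
  proof -
    \<comment> \<open>Deleting row and column 0 shifts both indices by one.\<close>
    have entry: "core G $$ (i, j) = G $$ (Suc i, Suc j)" if "Suc i < q" "Suc j < q" for i j
      using that G mat_delete_index[of G "q - 1" 0 0 i j] by (simp add: core_def insert_index_def)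
    have "dim_row (core G) = q - 1" "dim_col (core G) = q - 1"
      using G by (auto simp: core_def)
    then have "core G $$ (a, b) = core G $$ (b, a)"
      using sym that unfolding symmetric_matrix_def
      by (metis index_transpose_mat(1) less_diff_conv Suc_eq_plus1)
    then show ?thesis
      using that by (simp add: entry)
  qed
  \<comment> \<open>Negating row 0 turns its off-diagonal entries into \<open>- 1\<close>, matching
    column 0; away from row and column 0 this is the symmetry of the core.\<close>
  have "d a * G $$ (a, b) = d b * G $$ (b, a)" if "a < q" "b < q" for a b
    using that row col core_sym by (cases a; cases b) (auto simp: d_def)
  from MG_weighted_orthogonality[OF assms(2) this pt]
  have "(\<Sum>s\<in>V n q. (\<Prod>a<q. d a ^ (s $ a)) * MG G p s * cnj (MG G s t)) =
      (\<Prod>a<q. d a ^ (t $ a)) * of_nat q ^ n * (if p = t then 1 else 0)"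
    by simp
  moreover have "(\<Prod>a<q. d a ^ (s $ a)) = (- 1) ^ (s $ 0)" for s :: "nat vec"
  proof -
    have "(\<Prod>a<q. d a ^ (s $ a)) = (\<Prod>a<q. if a = 0 then (- 1) ^ (s $ a) else 1)"
      by (intro prod.cong) (auto simp: d_def)
    then show ?thesis
      using assms(1) by simp
  qed
  ultimately show "(\<Sum>s\<in>V n q. (- 1) ^ (s $ 0) * MG G p s * cnj (MG G s t)) =
      (- 1) ^ (t $ 0) * of_nat q ^ n * (if p = t then 1 else 0)"
    by simp
qed

end
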